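(* Let $A_0=1$ and for $p>0$ let $A_p = (-1)^p + 2\sum_{j=0}^{\lfloor p/2\rfloor}\binom{p}{2j+1}A_{p-2j-1}$; let $B_0=1$ and for $p>0$ let $B_p = 2\sum_{j=0}^{\lfloor p/2\rfloor}\binom{p}{2j+1}B_{p-2j-1}$. For integers $p\ge 0$ and $n\ge 0$ let $\mathcal{S}_n^{(p)} = \sum_{i=0}^{n} i^p F_{i}$, where $i^0$ is interpreted as $1$ (also for $i=0$). Then for all integers $p\ge 0$ and $n \ge 0$, \[ \mathcal{S}_n^{(p)} \;=\; \left(\sum_{k=0}^{p}\binom{p}{k}(-1)^k A_k\, n^{p-k}\right)F_n \;+\; \left(\sum_{k=0}^{p}\binom{p}{k}(-1)^k B_k\, n^{p-k}\right)F_{n+1} \;-\; (-1)^p B_p. \]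
   Context: $F_n$ denotes the Fibonacci numbers: $F_0=0$, $F_1=1$, $F_n=F_{n-1}+F_{n-2}$ for $n>1$. Binomial coefficients $\binom{p}{m}$ with $m>p$ are $0$, so in the recursive definitions only terms with $2j+1\le p$ contribute. The convention $0^0=1$ is used throughout. *)

theory Defs
  imports Main "HOL-Number_Theory.Fib"
begin

(* In both recursions the upper summation limit is p div 2, so for even p the last
   index j = p div 2 gives 2 * j + 1 = p + 1 > p; that term vanishes since its binomial
   coefficient is 0, whatever the value of the truncated subtraction p - (2 * j + 1). *)

function A :: "nat \<Rightarrow> int" where
  "A p = (if p = 0 then 1
          else (-1) ^ p + 2 * (\<Sum>j = 0..p div 2. int (p choose (2 * j + 1)) * A (p - (2 * j + 1))))"
  by pat_completeness auto
termination by (relation "measure id") auto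

function B :: "nat \<Rightarrow> int" where
  "B p = (if p = 0 then 1
          else 2 * (\<Sum>j = 0..p div 2. int (p choose (2 * j + 1)) * B (p - (2 * j + 1))))"
  by pat_completeness auto
termination by (relation "measure id") auto

(* The unconditional recursion equations would make the simplifier loop. *)
declare A.simps [simp del] B.simps [simp del]

definition S :: "nat \<Rightarrow> nat \<Rightarrow> int" where
  "S p n = (\<Sum>i = 0..n. int i ^ p * int (fib i))"

end

theory Submission
  imports Defs "HOL-Computational_Algebra.Formal_Power_Series"
begin

unbundle fps_syntax

text \<open>
  Put \<open>a\<^sub>k = (-1)\<^sup>k A\<^sub>k\<close> and \<open>b\<^sub>k = (-1)\<^sup>k B\<^sub>k\<close>. In terms of exponential generating functions the
  recursions say \<open>a(t) (1 + 2 sinh t) = e\<^sup>t\<close> and \<open>b(t) (1 + 2 sinh t) = 1\<close>. The polynomials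
  \<open>P\<^sub>p(x)\<close> and \<open>Q\<^sub>p(x)\<close> multiplying \<open>F\<^sub>n\<close> and \<open>F\<^sub>n\<^sub>+\<^sub>1\<close> are the Appell polynomials with generating
  functions \<open>a(t) e\<^sup>x\<^sup>t\<close> and \<open>b(t) e\<^sup>x\<^sup>t\<close>, so \<open>Q\<^sub>p(x + 1) = P\<^sub>p(x)\<close> and
  \<open>P\<^sub>p(x + 1) + Q\<^sub>p(x + 1) - Q\<^sub>p(x) = (x + 1)\<^sup>p\<close>. These two identities are exactly what makes the
  sum telescope.
\<close>

definition egf :: "(nat \<Rightarrow> int) \<Rightarrow> real fps" where
  "egf f = Abs_fps (\<lambda>k. of_int (f k) / fact k)"

lemma egf_nth [simp]: "egf f $ k = of_int (f k) / fact k"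
  by (simp add: egf_def)

lemma egf_eq_iff: "egf f = egf g \<longleftrightarrow> f = g"
  by (auto simp: fps_eq_iff)

lemma egf_add: "egf f + egf g = egf (\<lambda>k. f k + g k)"
  by (simp add: fps_eq_iff add_divide_distrib)

lemma egf_diff: "egf f - egf g = egf (\<lambda>k. f k - g k)"
  by (simp add: fps_eq_iff diff_divide_distrib)

lemma egf_mult:
  "egf f * egf g = egf (\<lambda>n. \<Sum>k = 0..n. int (n choose k) * f k * g (n - k))"
proof (rule fps_ext)
  fix n
  have "(egf f * egf g) $ n = (\<Sum>k = 0..n. of_int (f k) / fact k * (of_int (g (n - k)) / fact (n - k)))"
    by (simp add: fps_mult_nth)
  also have "\<dots> = (\<Sum>k = 0..n. of_int (int (n choose k) * f k * g (n - k)) / fact n)"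
    by (rule sum.cong) (simp_all add: binomial_fact)
  finally show "(egf f * egf g) $ n =
      egf (\<lambda>n. \<Sum>k = 0..n. int (n choose k) * f k * g (n - k)) $ n"
    by (simp add: sum_divide_distrib)
qed

lemma fps_exp_eq_egf: "fps_exp (of_int c) = egf (\<lambda>k. c ^ k)"
  by (simp add: fps_eq_iff)

text \<open>The factor \<open>1 ^ k - (-1) ^ k\<close> is 0 for even \<open>k\<close> and 2 for odd
  \<open>k\<close>; it is the coefficient sequence of 2 sinh.\<close>

lemma sum_odd_binomial:
  fixes f :: "nat \<Rightarrow> int"
  shows "(\<Sum>k = 0..p. int (p choose k) * (1 ^ k - (-1) ^ k) * f (p - k)) =
    2 * (\<Sum>j = 0..p div 2. int (p choose (2 * j + 1)) * f (p - (2 * j + 1)))"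
proof -
  let ?g = "\<lambda>k. int (p choose k) * (1 ^ k - (-1) ^ k) * f (p - k)"
  have "(\<Sum>k = 0..p. ?g k) = (\<Sum>k \<in> (\<lambda>j. 2 * j + 1) ` {0..p div 2}. ?g k)"
  \<comment> \<open>Neither index set need contain the other: for even \<open>p\<close> the image
    also holds \<open>p + 1\<close>, where the binomial coefficient vanishes.\<close>
  proof (rule sum.mono_neutral_cong)
    fix k assume k: "k \<in> {0..p} - (\<lambda>j. 2 * j + 1) ` {0..p div 2}"
    have "even k"
    proof (rule ccontr)
      assume "odd k"
      then obtain j where "k = 2 * j + 1" by (elim oddE)
      with k show False by auto
    qed
    then show "?g k = 0" by simp
  qed auto
  also have "\<dots> = (\<Sum>j = 0..p div 2. ?g (2 * j + 1))"
    by (subst sum.reindex) (auto simp: inj_on_def)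
  also have "\<dots> = 2 * (\<Sum>j = 0..p div 2. int (p choose (2 * j + 1)) * f (p - (2 * j + 1)))"
    by (simp add: sum_distrib_left algebra_simps)
  finally show ?thesis .
qed

text \<open>The alternating sign of \<open>f\<close> against the odd index shift flips the sign of the sum.\<close>
lemma egf_alternating_recursion:
  assumes "\<And>p. f p = c p + 2 * (\<Sum>j = 0..p div 2. int (p choose (2 * j + 1)) * f (p - (2 * j + 1)))"
  shows "egf (\<lambda>k. (-1) ^ k * f k) * (1 + (fps_exp 1 - fps_exp (- 1))) = egf (\<lambda>k. (-1) ^ k * c k)"
proof -
  let ?h = "\<lambda>k. (-1) ^ k * f k"
  have rec: "?h p + (\<Sum>k = 0..p. int (p choose k) * (1 ^ k - (-1) ^ k) * ?h (p - k)) =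
      (-1) ^ p * c p" for p
  proof -
    have "(-1) ^ p * (int (p choose (2 * j + 1)) * f (p - (2 * j + 1))) =
        - (int (p choose (2 * j + 1)) * ?h (p - (2 * j + 1)))" for j
    \<comment> \<open>The parities of \<open>p\<close> and \<open>p - (2 * j + 1)\<close> differ
      only when the subtraction does not truncate; otherwise both sides are 0.\<close>
    proof (cases "2 * j + 1 \<le> p")
      case True
      then obtain d where "p = 2 * j + 1 + d" using le_Suc_ex by blast
      then show ?thesis by (simp add: power_add)
    qed (simp add: binomial_eq_0)
    then have "(-1) ^ p * (\<Sum>j = 0..p div 2. int (p choose (2 * j + 1)) * f (p - (2 * j + 1))) =
        - (\<Sum>j = 0..p div 2. int (p choose (2 * j + 1)) * ?h (p - (2 * j + 1)))"
      by (simp only: sum_distrib_left sum_negf)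
    then show ?thesis
      by (subst assms, subst sum_odd_binomial) (simp add: algebra_simps)
  qed
  have "fps_exp 1 - fps_exp (- 1) = egf (\<lambda>k. 1 ^ k - (-1) ^ k)"
    using fps_exp_eq_egf[of 1] fps_exp_eq_egf[of "-1"] by (simp add: egf_diff)
  then have "egf ?h * (1 + (fps_exp 1 - fps_exp (- 1))) =
      egf ?h + egf (\<lambda>k. 1 ^ k - (-1) ^ k) * egf ?h"
    by (simp add: algebra_simps)
  also have "\<dots> = egf (\<lambda>k. (-1) ^ k * c k)"
    by (simp only: egf_mult egf_add rec)
  finally show ?thesis .
qed

text \<open>The sign is grouped with \<open>A k\<close> so that the body is literally the binomial
  convolution in \<open>egf_mult\<close>.\<close>

definition P :: "nat \<Rightarrow> int \<Rightarrow> int" where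
  "P p x = (\<Sum>k = 0..p. int (p choose k) * ((-1) ^ k * A k) * x ^ (p - k))"

definition Q :: "nat \<Rightarrow> int \<Rightarrow> int" where
  "Q p x = (\<Sum>k = 0..p. int (p choose k) * ((-1) ^ k * B k) * x ^ (p - k))"

lemma egf_P: "egf (\<lambda>p. P p x) = egf (\<lambda>k. (-1) ^ k * A k) * fps_exp (of_int x)"
  unfolding fps_exp_eq_egf egf_mult P_def ..

lemma egf_Q: "egf (\<lambda>p. Q p x) = egf (\<lambda>k. (-1) ^ k * B k) * fps_exp (of_int x)"
  unfolding fps_exp_eq_egf egf_mult Q_def ..

lemma egf_A: "egf (\<lambda>k. (-1) ^ k * A k) * (1 + (fps_exp 1 - fps_exp (- 1))) = fps_exp 1"
proof -
  have "A p = (-1) ^ p + 2 * (\<Sum>j = 0..p div 2. int (p choose (2 * j + 1)) * A (p - (2 * j + 1)))" for p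
    using A.simps[of p] by (cases "p = 0") simp_all
  then have "egf (\<lambda>k. (-1) ^ k * A k) * (1 + (fps_exp 1 - fps_exp (- 1))) =
      egf (\<lambda>k. (-1) ^ k * (-1) ^ k)"
    by (rule egf_alternating_recursion)
  also have "\<dots> = fps_exp 1"
    using fps_exp_eq_egf[of 1] by (simp flip: power_mult_distrib)
  finally show ?thesis .
qed

lemma egf_B: "egf (\<lambda>k. (-1) ^ k * B k) * (1 + (fps_exp 1 - fps_exp (- 1))) = 1"
proof -
  \<comment> \<open>The term \<open>0 ^ p\<close> absorbs the initial value, since the sum vanishes
    at \<open>p = 0\<close>.\<close>
  have "B p = 0 ^ p + 2 * (\<Sum>j = 0..p div 2. int (p choose (2 * j + 1)) * B (p - (2 * j + 1)))" for p
    using B.simps[of p] by (cases "p = 0") simp_all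
  then have "egf (\<lambda>k. (-1) ^ k * B k) * (1 + (fps_exp 1 - fps_exp (- 1))) =
      egf (\<lambda>k. (-1) ^ k * 0 ^ k)"
    by (rule egf_alternating_recursion)
  also have "\<dots> = 1"
    by (simp add: fps_eq_iff power_0_left)
  finally show ?thesis .
qed

text \<open>By \<open>egf_B\<close> the series of \<open>B\<close> is the inverse of 1 + 2 sinh, so
  it can be multiplied in where \<open>egf_A\<close> would call for a division.\<close>

lemma egf_A_eq_egf_B: "egf (\<lambda>k. (-1) ^ k * A k) = egf (\<lambda>k. (-1) ^ k * B k) * fps_exp 1"
  (is "?a = ?b * ?e")
proof -
  let ?d = "1 + (fps_exp 1 - fps_exp (- 1)) :: real fps"
  have "?a = ?a * (?b * ?d)"
    by (simp only: egf_B mult_1_right)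
  also have "\<dots> = ?b * (?a * ?d)"
    by (simp only: mult_ac)
  finally show ?thesis
    by (simp only: egf_A)
qed

text \<open>Raising \<open>x\<close> by 1 contributes a factor \<open>fps_exp 1\<close>, which turns
  the series of \<open>B\<close> into that of \<open>A\<close>.\<close>

lemma Q_shift: "Q p (x + 1) = P p x"
proof -
  have "egf (\<lambda>p. Q p (x + 1)) = egf (\<lambda>p. P p x)"
    unfolding egf_P egf_Q egf_A_eq_egf_B by (simp add: fps_exp_add_mult mult_ac)
  then show ?thesis by (simp add: egf_eq_iff fun_eq_iff)
qed

lemma P_Q_shift: "P p (x + 1) + Q p (x + 1) - Q p x = (x + 1) ^ p"
proof -
  let ?b = "egf (\<lambda>k. (-1) ^ k * B k)"
  let ?e = "fps_exp 1 :: real fps" and ?e' = "fps_exp (- 1) :: real fps"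
  let ?x = "fps_exp (of_int x) :: real fps"
  have inv: "?e * ?e' = 1"
    by (simp flip: fps_exp_add_mult)
  have "egf (\<lambda>p. P p (x + 1) + Q p (x + 1) - Q p x) = ?b * ?e * (?x * ?e) + ?b * (?x * ?e) - ?b * ?x"
    by (simp add: egf_P egf_Q egf_A_eq_egf_B fps_exp_add_mult flip: egf_add egf_diff)
  \<comment> \<open>Inserting \<open>?e * ?e'\<close> lets \<open>?x * ?e\<close> be factored out of
    all three terms, leaving 1 + 2 sinh, which \<open>?b\<close> cancels.\<close>
  also have "\<dots> = ?b * ?e * (?x * ?e) + ?b * (?x * ?e) - ?b * ?x * (?e * ?e')"
    by (simp add: inv)
  also have "\<dots> = ?x * ?e * (?b * (1 + (?e - ?e')))"
    by (simp only: algebra_simps mult_1_left)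
  also have "\<dots> = fps_exp (of_int (x + 1))"
    by (simp only: egf_B) (simp add: fps_exp_add_mult)
  also have "\<dots> = egf (\<lambda>p. (x + 1) ^ p)"
    by (rule fps_exp_eq_egf)
  finally show ?thesis by (simp add: egf_eq_iff fun_eq_iff)
qed

text \<open>This is the constant of the closed form: at \<open>n = 0\<close> only the
  \<open>fib 1\<close> term survives, and the constant cancels it.\<close>

lemma Q_0: "Q p 0 = (-1) ^ p * B p"
proof -
  have "egf (\<lambda>p. Q p 0) = egf (\<lambda>k. (-1) ^ k * B k)"
    by (simp add: egf_Q)
  then show ?thesis by (simp add: egf_eq_iff fun_eq_iff)
qed

lemma S_eq: "S p n = P p (int n) * int (fib n) + Q p (int n) * int (fib (n + 1)) - (-1) ^ p * B p"
proof (induction n)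
  case 0
  then show ?case by (simp add: S_def Q_0)
next
  case (Suc n)
  have "S p (Suc n) = S p n + (int n + 1) ^ p * int (fib (Suc n))"
    by (simp add: S_def add.commute)
  \<comment> \<open>Expanding the new power by \<open>P_Q_shift\<close> cancels
    \<open>Q p (int n)\<close>, and \<open>Q_shift\<close> makes \<open>P p (int n)\<close>, the
    coefficient of \<open>fib n\<close>, equal to \<open>Q p (int n + 1)\<close>.\<close>
  also have "\<dots> = P p (int n + 1) * int (fib (Suc n)) + Q p (int n + 1) * (int (fib n) + int (fib (Suc n))) -
      (-1) ^ p * B p"
    unfolding Suc.IH P_Q_shift[symmetric] Q_shift by (simp add: algebra_simps)
  finally show ?case by (simp add: add.commute)
qed

theorem theorem3:
  fixes p n :: nat
  shows "S p n =
      (\<Sum>k = 0..p. int (p choose k) * (-1) ^ k * A k * int n ^ (p - k)) * int (fib n)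
    + (\<Sum>k = 0..p. int (p choose k) * (-1) ^ k * B k * int n ^ (p - k)) * int (fib (n + 1))
    - (-1) ^ p * B p"
  using S_eq[of p n] by (simp add: P_def Q_def mult.assoc)

end
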